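(* Let $u$ be a packed word of length $n$ with $\max(u)=r$, and let $\mathbf{K}_u:=\mathbf{N}_u*E_n^{[r]}\in\mathbf{WQSym}_n^*$. Then $$\mathbf{K}_u=\sum_{v\ge u}\frac{(-1)^{\max(v)-\max(u)}}{\prod_{i=1}^{r}\ell_i(v,u)}\,\mathbf{N}_v,$$ where the sum is over packed words $v$ of length $n$ finer than $u$, and $\ell_i(v,u)$ is the number of distinct letters $v_j$ with $u_j=i$ (i.e. the number of blocks of $v$ contained in the $i$-th block of $u$).
   Context: $\mathbb{K}$ is a field of characteristic $0$. A word over the positive integers is packed if its set of letters is $\{1,\dots,r\}$ for some $r$; then $r=\max(u)$. For a word $w$ over a totally ordered alphabet with distinct letters $b_1<\dots<b_r$, $\mathrm{pack}(w)$ is obtained by replacing each $b_i$ by $i$. A packed word $u=u_1\cdots u_n$ is identified with the set composition (ordered set partition) of $\{1,\dots,n\}$ whose $i$-th block is $\{j: u_j=i\}$. For packed words $u,v$ of length $n$, $v$ is finer than $u$, written $v\ge u$, if the set composition $u$ is obtained from $v$ by merging some consecutive blocks (equivalently $v_i\le v_j\Rightarrow u_i\le u_j$ for all $i,j$). $\mathbf{WQSym}^*_n$ is the $\mathbb{K}$-vector space with basis $\mathbf{N}_u$, $u$ running over packed words of length $n$, with internal product $\mathbf{N}_u*\mathbf{N}_v=\mathbf{N}_{\mathrm{pack}\binom{u}{v}}$, where $\binom{u}{v}$ is the word of biletters $\binom{u_1}{v_1}\cdots\binom{u_n}{v_n}$, biletters being ordered lexicographically with priority to the top letter. The Eulerian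 idempotents $E_n^{[k]}$ are the elements of $\mathbf{WQSym}_n^*$ defined by $$\sum_{k=1}^n t^kE_n^{[k]}=\sum_{|u|=n}\binom{t}{\max(u)}\mathbf{N}_u ,$$ the sum being over all packed words of length $n$ (this is the degree $n$ component of $\sigma_1^t$, where $\sigma_1=\sum_{n\ge 0}S_n$ and $S_n=\mathbf{N}_{1^n}$), $t$ being an indeterminate. *)

theory Defs
  imports
    "HOL-Library.Poly_Mapping"
    "HOL-Library.Product_Lexorder"
    "HOL-Computational_Algebra.Polynomial"
begin

section \<open>Packed words\<close>

text \<open>A word is a list; positions are counted from 0, letters from 1.\<close>

definition packed :: "nat list \<Rightarrow> bool" where
  "packed w \<longleftrightarrow> (\<exists>r. set w = {1..r})"

text \<open>The maximal letter; the inserted 0 only matters for the empty word.\<close>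

definition wmax :: "nat list \<Rightarrow> nat" where
  "wmax w = Max (insert 0 (set w))"

definition packed_words :: "nat \<Rightarrow> nat list set" where
  "packed_words n = {w. packed w \<and> length w = n}"

text \<open>The letter \<open>b\<^sub>i\<close> is replaced by its rank \<open>i\<close> among the distinct letters of the word.\<close>

definition pack :: "'a::linorder list \<Rightarrow> nat list" where
  "pack w = map (\<lambda>x. card {b \<in> set w. b \<le> x}) w"

definition block :: "nat list \<Rightarrow> nat \<Rightarrow> nat set" where
  "block w i = {j. j < length w \<and> w ! j = i}"

definition set_comp :: "nat list \<Rightarrow> nat set list" where
  "set_comp w = map (block w) [1..<Suc (wmax w)]"

text \<open>Merging consecutive entries of a list of sets: cut the list into nonempty segments and
  replace each segment by its union.\<close>

definition merges_to :: "nat set list \<Rightarrow> nat set list \<Rightarrow> bool" where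
  "merges_to Bs As \<longleftrightarrow>
     (\<exists>segs. [] \<notin> set segs \<and> concat segs = Bs \<and> map (\<lambda>seg. \<Union>(set seg)) segs = As)"

definition finer :: "nat list \<Rightarrow> nat list \<Rightarrow> bool" where
  "finer v u \<longleftrightarrow> length v = length u \<and> merges_to (set_comp v) (set_comp u)"

definition ell :: "nat list \<Rightarrow> nat list \<Rightarrow> nat \<Rightarrow> nat" where
  "ell v u i = card {v ! j | j. j < length u \<and> u ! j = i}"

lemma finite_packed_words: "finite (packed_words n)"
proof (rule finite_subset)
  show "packed_words n \<subseteq> {w. set w \<subseteq> {..n} \<and> length w = n}"
  proof
    fix w assume "w \<in> packed_words n"
    then obtain r where r: "set w = {1..r}" "length w = n"
      by (auto simp: packed_words_def packed_def)
    have "card (set w) \<le> n" using card_length[of w] r(2) by simp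
    with r show "w \<in> {w. set w \<subseteq> {..n} \<and> length w = n}" by auto
  qed
qed (simp add: finite_lists_length_eq)

lemma packed_set_eq:
  assumes "packed w" shows "set w = {1..wmax w}"
proof -
  obtain r where r: "set w = {1..r}" using assms by (auto simp: packed_def)
  have "wmax w = r" unfolding wmax_def r by (rule Max_eqI) (cases "r = 0"; auto)+
  with r show ?thesis by simp
qed

lemma wmax_le_length:
  assumes "packed w" shows "wmax w \<le> length w"
  using card_length[of w] packed_set_eq[OF assms] by simp

lemma length_pack [simp]: "length (pack w) = length w"
  by (simp add: pack_def)

lemma pack_le_iff:
  assumes "i < length w" "j < length w"
  shows "pack w ! i \<le> pack w ! j \<longleftrightarrow> w ! i \<le> w ! j"
proof -
  let ?S = "\<lambda>x. {b \<in> set w. b \<le> x}"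
  have le: "card (?S x) \<le> card (?S y)" if "x \<le> y" for x y
    by (rule card_mono) (use that in auto)
  have "card (?S (w ! j)) < card (?S (w ! i))" if lt: "w ! j < w ! i"
  proof (rule psubset_card_mono)
    have "w ! i \<in> ?S (w ! i)" "w ! i \<notin> ?S (w ! j)" using lt assms by auto
    moreover have "?S (w ! j) \<subseteq> ?S (w ! i)" using lt by auto
    ultimately show "?S (w ! j) \<subset> ?S (w ! i)" by blast
  qed simp
  then have "card (?S (w ! i)) \<le> card (?S (w ! j)) \<longleftrightarrow> w ! i \<le> w ! j"
    using le by (meson not_le)
  then show ?thesis using assms by (simp add: pack_def)
qed

lemma packed_pack: "packed (pack w)"
proof -
  let ?f = "\<lambda>x. card {b \<in> set w. b \<le> x}"
  have inj: "inj_on ?f (set w)"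
  proof (rule inj_onI)
    fix x y assume "x \<in> set w" "y \<in> set w" and eq: "?f x = ?f y"
    then obtain i j where "i < length w" "j < length w" "x = w ! i" "y = w ! j"
      by (auto simp: in_set_conv_nth)
    with eq pack_le_iff[of i w j] pack_le_iff[of j w i] show "x = y"
      by (simp add: pack_def)
  qed
  have sub: "?f ` set w \<subseteq> {1..card (set w)}"
  proof
    fix y assume "y \<in> ?f ` set w"
    then obtain x where x: "x \<in> set w" "y = ?f x" by auto
    have "0 < ?f x" unfolding card_gt_0_iff using x(1) by auto
    moreover have "?f x \<le> card (set w)" by (rule card_mono) auto
    ultimately show "y \<in> {1..card (set w)}" using x(2) by simp
  qed
  have "?f ` set w = {1..card (set w)}"
    by (rule card_subset_eq) (use sub card_image[OF inj] in auto)
  then show ?thesis unfolding packed_def pack_def by auto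
qed

lemma sorted_wrt_concatD:
  assumes "sorted_wrt P (concat segs)" "a < b" "b < length segs"
    "x \<in> set (segs ! a)" "y \<in> set (segs ! b)"
  shows "P x y"
  using assms
proof (induction segs arbitrary: a b)
  case (Cons s segs)
  show ?case
  proof (cases a)
    case 0
    then obtain b' where "b = Suc b'" using Cons.prems by (cases b) auto
    then have "y \<in> set (concat segs)" using Cons.prems nth_mem[of b' segs] by auto
    then show ?thesis using Cons.prems 0 by (auto simp: sorted_wrt_append)
  next
    case (Suc a')
    then obtain b' where "b = Suc b'" using Cons.prems by (cases b) auto
    then show ?thesis using Suc Cons by (auto simp: sorted_wrt_append)
  qed
qed simp

lemma concat_filter_sorted:
  fixes f :: "'b \<Rightarrow> nat"
  assumes "sorted (map f ks)"
  shows "concat (map (\<lambda>i. filter (\<lambda>k. f k = i) ks) [a..<b]) = filter (\<lambda>k. a \<le> f k \<and> f k < b) ks"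
  (is "?L b = ?R b")
proof (induction b)
  case (Suc b)
  show ?case
  proof (cases "a \<le> b")
    case True
    have "?R (Suc b) = ?R b @ filter (\<lambda>k. f k = b) ks"
      using assms True
    proof (induction ks)
      case (Cons k ks)
      show ?case
      proof (cases "f k < b \<or> f k \<noteq> b")
        case True
        with Cons show ?thesis by (cases "f k < b") (auto simp: filter_empty_conv)
      next
        case False
        with Cons have "filter (\<lambda>k. a \<le> f k \<and> f k < b) (k # ks) = []"
          by (auto simp: filter_empty_conv)
        with Cons False show ?thesis by auto
      qed
    qed simp
    with Suc True show ?thesis by simp
  qed (auto simp: filter_empty_conv)
qed simp

lemma finer_iff:
  assumes u: "packed u" and v: "packed v" and len: "length v = length u"
  shows "finer v u \<longleftrightarrow> (\<forall>i<length u. \<forall>j<length u. v ! i \<le> v ! j \<longrightarrow> u ! i \<le> u ! j)"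
proof
  assume "finer v u"
  then obtain segs where segs: "concat segs = set_comp v"
      "map (\<lambda>seg. \<Union>(set seg)) segs = set_comp u"
    by (auto simp: finer_def merges_to_def)
  have lsegs: "length segs = wmax u"
    using arg_cong[OF segs(2), of length] by (simp add: set_comp_def)
  have nth: "\<Union>(set (segs ! a)) = block u (Suc a)" if "a < wmax u" for a
    using arg_cong[OF segs(2), of "\<lambda>l. l ! a"] that lsegs
    by (simp add: set_comp_def del: upt_Suc)
  have srt: "sorted_wrt (\<lambda>B B'. \<forall>x\<in>B. \<forall>y\<in>B'. v ! x < v ! y) (concat segs)"
    unfolding segs(1) set_comp_def sorted_wrt_map
    by (rule sorted_wrt_mono_rel[OF _ sorted_wrt_upt]) (auto simp: block_def)
  show "\<forall>i<length u. \<forall>j<length u. v ! i \<le> v ! j \<longrightarrow> u ! i \<le> u ! j"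
  proof (intro allI impI, rule ccontr)
    fix i j assume i: "i < length u" and j: "j < length u" and le: "v ! i \<le> v ! j"
      and "\<not> u ! i \<le> u ! j"
    then have lt: "u ! j < u ! i" by simp
    have ui: "u ! i \<in> {1..wmax u}" and uj: "u ! j \<in> {1..wmax u}"
      using packed_set_eq[OF u] i j nth_mem by blast+
    have "i \<in> block u (u ! i)" "j \<in> block u (u ! j)" using i j by (auto simp: block_def)
    then have "i \<in> \<Union>(set (segs ! (u ! i - 1)))" "j \<in> \<Union>(set (segs ! (u ! j - 1)))"
      using nth[of "u ! i - 1"] nth[of "u ! j - 1"] ui uj by (auto simp del: Union_iff)
    then obtain B B' where B: "B \<in> set (segs ! (u ! i - 1))" "i \<in> B"
        and B': "B' \<in> set (segs ! (u ! j - 1))" "j \<in> B'" by auto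
    have "\<forall>x\<in>B'. \<forall>y\<in>B. v ! x < v ! y"
      by (rule sorted_wrt_concatD[OF srt _ _ B'(1) B(1)]) (use lt ui uj lsegs in auto)
    with B B' le show False by (meson leD)
  qed
next
  assume mono: "\<forall>i<length u. \<forall>j<length u. v ! i \<le> v ! j \<longrightarrow> u ! i \<le> u ! j"
  define p where "p k = (SOME j. j < length v \<and> v ! j = k)" for k
  define f where "f k = u ! p k" for k
  define ks where "ks = [1..<Suc (wmax v)]"
  have setks: "set ks = set v" unfolding packed_set_eq[OF v] by (auto simp: ks_def simp del: upt_Suc)
  have p: "p k < length v \<and> v ! p k = k" if "k \<in> set v" for k
    unfolding p_def
    by (rule someI_ex[of "\<lambda>j. j < length v \<and> v ! j = k"])
       (use that in \<open>simp add: in_set_conv_nth\<close>)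
  have f: "f (v ! j) = u ! j" if j: "j < length u" for j
  proof -
    have "p (v ! j) < length u" "v ! p (v ! j) = v ! j" using p[of "v ! j"] j len by auto
    then show ?thesis unfolding f_def using mono j by (metis order_antisym order_refl)
  qed
  have fin: "f k \<in> {1..wmax u}" if "k \<in> set v" for k
    using p[OF that] len packed_set_eq[OF u] nth_mem[of "p k" u] by (auto simp: f_def)
  have "sorted_wrt (\<lambda>x y. f x \<le> f y) ks"
  proof (rule sorted_wrt_mono_rel[of _ "(<)"])
    fix x y assume "x \<in> set ks" "y \<in> set ks" "x < y"
    with p[of x] p[of y] mono len setks show "f x \<le> f y" by (auto simp: f_def)
  qed (simp add: ks_def del: upt_Suc)
  then have "sorted (map f ks)" by (simp add: sorted_wrt_map)
  from concat_filter_sorted[OF this, of 1 "Suc (wmax u)"]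
  have conc: "concat (map (\<lambda>i. filter (\<lambda>k. f k = i) ks) [1..<Suc (wmax u)]) = ks"
    using fin setks by (auto simp: filter_id_conv less_Suc_eq_le simp del: upt_Suc)
  define segs where "segs = map (\<lambda>i. map (block v) (filter (\<lambda>k. f k = i) ks)) [1..<Suc (wmax u)]"
  have un: "(\<Union>k\<in>{k \<in> set v. f k = i}. block v k) = block u i" for i
    using f len by (auto simp: block_def)
  have ne: "[] \<notin> set segs"
  proof
    assume "[] \<in> set segs"
    then obtain i where i: "i \<in> {1..wmax u}" "\<forall>k\<in>set v. f k \<noteq> i"
      by (auto simp: segs_def filter_empty_conv setks less_Suc_eq_le simp del: upt_Suc)
    then obtain j where "j < length u" "u ! j = i"
      using packed_set_eq[OF u] by (metis in_set_conv_nth)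
    with f[of j] i(2) len show False by auto
  qed
  have "concat segs = map (block v) ks"
    unfolding segs_def by (subst (2) conc[symmetric]) (simp add: map_concat comp_def del: upt_Suc)
  moreover have "map (\<lambda>seg. \<Union>(set seg)) segs = set_comp u"
    using un setks by (simp add: segs_def set_comp_def comp_def del: upt_Suc)
  ultimately show "finer v u"
    using ne len unfolding finer_def merges_to_def set_comp_def[of v] ks_def by blast
qed

section \<open>The spaces of the dual of WQSym and the internal product\<close>

text \<open>Linear combinations of words are finitely supported functions on lists.\<close>

definition scale :: "'k::semiring_0 \<Rightarrow> ('w \<Rightarrow>\<^sub>0 'k) \<Rightarrow> ('w \<Rightarrow>\<^sub>0 'k)" where
  "scale c a = Poly_Mapping.map ((*) c) a"

definition N_elt :: "nat list \<Rightarrow> (nat list \<Rightarrow>\<^sub>0 'k::semiring_1)" where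
  "N_elt u = Poly_Mapping.single u 1"

definition WQSym_dual :: "nat \<Rightarrow> (nat list \<Rightarrow>\<^sub>0 'k::semiring_1) set" where
  "WQSym_dual n = {a. Poly_Mapping.keys a \<subseteq> packed_words n}"

text \<open>Bilinear extension of the product of basis elements. It is only meant for two arguments in
  the same \<open>WQSym_dual n\<close>: on words of different lengths, \<open>zip\<close> truncates. The order on pairs is
  the lexicographic one of \<open>Product_Lexorder\<close>.\<close>

definition internal_prod ::
  "(nat list \<Rightarrow>\<^sub>0 'k::comm_semiring_1) \<Rightarrow> (nat list \<Rightarrow>\<^sub>0 'k) \<Rightarrow> (nat list \<Rightarrow>\<^sub>0 'k)" (infixl \<open>\<star>\<close> 70)
  where "a \<star> b = (\<Sum>u\<in>Poly_Mapping.keys a. \<Sum>v\<in>Poly_Mapping.keys b.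
           scale (Poly_Mapping.lookup a u * Poly_Mapping.lookup b v) (N_elt (pack (zip u v))))"

lemma lookup_scale [simp]: "Poly_Mapping.lookup (scale c a) w = c * Poly_Mapping.lookup a w"
  by (simp add: scale_def Poly_Mapping.map.rep_eq when_def)

lemma lookup_N_elt: "Poly_Mapping.lookup (N_elt u) w = (if u = w then 1 else 0)"
  by (simp add: N_elt_def lookup_single when_def)

lemma internal_prod_superset:
  fixes a b :: "nat list \<Rightarrow>\<^sub>0 'k::comm_semiring_1"
  assumes "finite A" "finite B" "Poly_Mapping.keys a \<subseteq> A" "Poly_Mapping.keys b \<subseteq> B"
  shows "a \<star> b = (\<Sum>u\<in>A. \<Sum>v\<in>B.
           scale (Poly_Mapping.lookup a u * Poly_Mapping.lookup b v) (N_elt (pack (zip u v))))"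
proof -
  have z: "scale 0 x = 0" for x :: "nat list \<Rightarrow>\<^sub>0 'k"
    by (rule poly_mapping_eqI) simp
  have inner: "(\<Sum>v\<in>Poly_Mapping.keys b.
        scale (Poly_Mapping.lookup a u * Poly_Mapping.lookup b v) (N_elt (pack (zip u v))))
      = (\<Sum>v\<in>B. scale (Poly_Mapping.lookup a u * Poly_Mapping.lookup b v) (N_elt (pack (zip u v))))" for u
    by (rule sum.mono_neutral_left) (use assms in \<open>auto simp: in_keys_iff z\<close>)
  show ?thesis
    unfolding internal_prod_def inner
    by (rule sum.mono_neutral_left) (use assms in \<open>auto simp: in_keys_iff z\<close>)
qed

lemma internal_prod_N_elt: "N_elt u \<star> N_elt v = (N_elt (pack (zip u v)) :: nat list \<Rightarrow>\<^sub>0 'k::comm_semiring_1)"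
  by (rule poly_mapping_eqI)
     (simp add: internal_prod_superset[of "{u}" "{v}"] N_elt_def[of u] N_elt_def[of v])

lemma internal_prod_add_left: "(a + b) \<star> c = a \<star> c + b \<star> c"
  using keys_add[of a b]
  by (intro poly_mapping_eqI)
     (simp add: internal_prod_superset[of "Poly_Mapping.keys a \<union> Poly_Mapping.keys b" "Poly_Mapping.keys c"]
        lookup_add lookup_sum sum.distrib distrib_right)

lemma internal_prod_add_right: "a \<star> (b + c) = a \<star> b + a \<star> c"
  using keys_add[of b c]
  by (intro poly_mapping_eqI)
     (simp add: internal_prod_superset[of "Poly_Mapping.keys a" "Poly_Mapping.keys b \<union> Poly_Mapping.keys c"]
        lookup_add lookup_sum sum.distrib distrib_right distrib_left)

lemma keys_scale: "Poly_Mapping.keys (scale c a) \<subseteq> Poly_Mapping.keys a"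
  by (auto simp: in_keys_iff)

lemma internal_prod_scale_left: "scale c a \<star> b = scale c (a \<star> b)"
  by (intro poly_mapping_eqI)
     (simp add: internal_prod_superset[of "Poly_Mapping.keys a" "Poly_Mapping.keys b" "scale c a" b] keys_scale
        internal_prod_superset[of "Poly_Mapping.keys a" "Poly_Mapping.keys b" a b]
        lookup_sum sum_distrib_left mult.assoc)

lemma internal_prod_scale_right: "a \<star> scale c b = scale c (a \<star> b)"
  by (intro poly_mapping_eqI)
     (simp add: internal_prod_superset[of "Poly_Mapping.keys a" "Poly_Mapping.keys b" a "scale c b"] keys_scale
        internal_prod_superset[of "Poly_Mapping.keys a" "Poly_Mapping.keys b" a b]
        lookup_sum sum_distrib_left ac_simps)

lemma internal_prod_closed:
  assumes "a \<in> WQSym_dual n" "b \<in> WQSym_dual n"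
  shows "a \<star> b \<in> WQSym_dual n"
proof -
  have "w \<in> packed_words n" if w: "Poly_Mapping.lookup (a \<star> b) w \<noteq> 0" for w
  proof -
    have "\<exists>u\<in>Poly_Mapping.keys a. \<exists>v\<in>Poly_Mapping.keys b. w = pack (zip u v)"
    proof (rule ccontr)
      assume "\<not> ?thesis"
      then have "\<forall>u\<in>Poly_Mapping.keys a. \<forall>v\<in>Poly_Mapping.keys b. pack (zip u v) \<noteq> w"
        by metis
      then have "Poly_Mapping.lookup (a \<star> b) w = 0"
        by (auto simp: internal_prod_def lookup_sum lookup_N_elt intro!: sum.neutral)
      with w show False by simp
    qed
    then obtain u v where uv: "u \<in> Poly_Mapping.keys a" "v \<in> Poly_Mapping.keys b" "w = pack (zip u v)"
      by blast
    have "length u = n" "length v = n"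
      using uv(1,2) assms by (auto simp: WQSym_dual_def packed_words_def)
    then show ?thesis using uv(3) packed_pack[of "zip u v"]
      by (simp add: packed_words_def)
  qed
  then show ?thesis by (auto simp: WQSym_dual_def in_keys_iff)
qed

section \<open>Eulerian idempotents\<close>

text \<open>The binomial coefficient of the indeterminate \<open>[:0, 1:]\<close>. The library's \<open>(gchoose)\<close> is constrained
  to fields, so it cannot be used over \<open>'k poly\<close>.\<close>

definition binom_poly :: "nat \<Rightarrow> 'k::field_char_0 poly" where
  "binom_poly m = smult (inverse (fact m)) (\<Prod>i<m. [:0, 1:] - of_nat i)"

lemma poly_binom_poly: "poly (binom_poly m) x = x gchoose m"
  by (simp add: binom_poly_def poly_prod gbinomial_prod_rev lessThan_atLeast0 field_simps)

text \<open>The coefficient of \<open>t^k\<close>, where \<open>t\<close> is the indeterminate \<open>[:0, 1:]\<close> of \<open>'k poly\<close>;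
  see \<open>Eulerian_generating\<close> for the defining identity over \<open>'k poly\<close>.\<close>

definition Eulerian :: "nat \<Rightarrow> nat \<Rightarrow> (nat list \<Rightarrow>\<^sub>0 'k::field_char_0)" where
  "Eulerian n k = (\<Sum>u\<in>packed_words n. scale (coeff (binom_poly (wmax u)) k) (N_elt u))"

definition K_elt :: "nat list \<Rightarrow> (nat list \<Rightarrow>\<^sub>0 'k::field_char_0)" where
  "K_elt u = N_elt u \<star> Eulerian (length u) (wmax u)"

lemma lookup_Eulerian:
  "Poly_Mapping.lookup (Eulerian n k) w =
     (if w \<in> packed_words n then coeff (binom_poly (wmax w)) k else 0)"
  by (simp add: Eulerian_def lookup_sum lookup_N_elt finite_packed_words if_distrib cong: if_cong)

lemma Eulerian_in_WQSym_dual: "Eulerian n k \<in> WQSym_dual n"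
  by (auto simp: WQSym_dual_def in_keys_iff lookup_Eulerian split: if_splits)

lemma K_elt_in_WQSym_dual: "packed u \<Longrightarrow> K_elt u \<in> WQSym_dual (length u)"
  unfolding K_elt_def
  by (intro internal_prod_closed Eulerian_in_WQSym_dual)
     (simp add: WQSym_dual_def packed_words_def N_elt_def)

lemma degree_binom_poly: "degree (binom_poly m :: 'k::field_char_0 poly) \<le> m"
proof -
  have "degree (\<Prod>i<m. [:0, 1 :: 'k:] - of_nat i) \<le> (\<Sum>i<m. degree ([:0, 1 :: 'k:] - of_nat i))"
    using degree_prod_sum_le[of "{..<m}" "\<lambda>i. [:0, 1 :: 'k:] - of_nat i"] by (simp add: comp_def)
  also have "\<dots> \<le> (\<Sum>i<m. 1)"
    by (rule sum_mono) (simp add: of_nat_poly)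
  finally show ?thesis
    by (simp add: binom_poly_def)
qed

lemma Eulerian_generating:
  assumes "n \<ge> 1"
  shows "(\<Sum>k=1..n. scale (monom 1 k) (Poly_Mapping.map (\<lambda>c. [:c:]) (Eulerian n k))) =
         (\<Sum>u\<in>packed_words n. scale (binom_poly (wmax u) :: 'k::field_char_0 poly) (N_elt u))"
    (is "?L = ?R")
proof (rule poly_mapping_eqI)
  fix w
  let ?b = "binom_poly (wmax w) :: 'k poly"
  have R: "Poly_Mapping.lookup ?R w = (if w \<in> packed_words n then ?b else 0)"
    by (simp add: lookup_sum lookup_N_elt finite_packed_words if_distrib cong: if_cong)
  have L: "Poly_Mapping.lookup ?L w =
      (\<Sum>k=1..n. monom (Poly_Mapping.lookup (Eulerian n k :: nat list \<Rightarrow>\<^sub>0 'k) w) k)"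
    by (auto simp: lookup_sum Poly_Mapping.map.rep_eq when_def smult_monom
        mult.commute[of "monom _ _"] intro!: sum.cong)
  show "Poly_Mapping.lookup ?L w = Poly_Mapping.lookup ?R w"
  proof (cases "w \<in> packed_words n")
    case True
    then have "w \<noteq> []" "packed w" "length w = n"
      using assms by (auto simp: packed_words_def)
    then have m: "wmax w \<noteq> 0" "wmax w \<le> n"
      using packed_set_eq[of w] wmax_le_length[of w] by (auto intro!: gr0I)
    have "coeff ?b 0 = 0"
      using m(1) by (simp add: poly_0_coeff_0[symmetric] poly_binom_poly gbinomial_0_left)
    moreover have "coeff ?b k = 0" if "k > n" for k
      using degree_binom_poly[of "wmax w", where 'k = 'k] m(2) that by (intro coeff_eq_0) simp
    ultimately have "?b = (\<Sum>k=1..n. monom (coeff ?b k) k)"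
      by (intro poly_eqI) (auto simp: coeff_sum coeff_monom not_le Suc_le_eq)
    then show ?thesis unfolding L R using True by (simp add: lookup_Eulerian)
  next
    case False
    then show ?thesis unfolding L R by (simp add: lookup_Eulerian)
  qed
qed

end

theory Submission
  imports Defs "HOL-Library.FuncSet"
begin

text \<open>The coefficient of \<open>N\<^sub>w\<close> in \<open>K\<^sub>u\<close> is the coefficient of \<open>t\<^sup>r\<close> in the sum of the
  \<open>binom(t, max v)\<close> over all \<open>v\<close> with \<open>pack(u, v) = w\<close>. If \<open>w\<close> refines \<open>u\<close>, this sum is the product
  of the \<open>binom(t, \<ell>\<^sub>i)\<close>: at a natural number both count words. Each of the \<open>r\<close> factors is divisible
  by \<open>t\<close>, so the coefficient of \<open>t\<^sup>r\<close> is the product of the linear coefficients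
  \<open>(-1)^(\<ell>\<^sub>i - 1) / \<ell>\<^sub>i\<close>. If \<open>w\<close> does not refine \<open>u\<close>, the sum is empty.\<close>

section \<open>Packing and order patterns\<close>

text \<open>Both images are in bijection with the classes of the common kernel of \<open>f\<close>
  and \<open>g\<close> on \<open>S\<close>.\<close>

lemma card_image_eq_if_same_kernel:
  assumes "\<And>x y. x \<in> S \<Longrightarrow> y \<in> S \<Longrightarrow> f x = f y \<longleftrightarrow> g x = g y"
  shows "card (f ` S) = card (g ` S)"
proof -
  have h: "inv_into S f (f x) \<in> S \<and> g (inv_into S f (f x)) = g x" if "x \<in> S" for x
    using that assms by (metis f_inv_into_f imageI inv_into_into)
  have "bij_betw (\<lambda>y. g (inv_into S f y)) (f ` S) (g ` S)"
    unfolding bij_betw_def inj_on_def using h assms by (auto simp: image_image)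
  then show ?thesis by (rule bij_betw_same_card)
qed

lemma pack_packed:
  assumes "packed w" shows "pack w = w"
proof -
  have "{b \<in> set w. b \<le> x} = {1..x}" if "x \<in> set w" for x
    using that packed_set_eq[OF assms] by auto
  then show ?thesis by (simp add: pack_def map_idI)
qed

text \<open>The rank of a letter depends only on the comparisons: the letters below the one at
  position \<open>i\<close> are the images of the same positions under \<open>x\<close> and under
  \<open>w\<close>. A packed \<open>w\<close> is its own packing.\<close>

lemma pack_eq_iff:
  fixes x :: "'a::linorder list" and w :: "nat list"
  assumes "packed w" and len: "length x = length w"
  shows "pack x = w \<longleftrightarrow> (\<forall>i<length w. \<forall>j<length w. x ! i \<le> x ! j \<longleftrightarrow> w ! i \<le> w ! j)"
proof
  assume "pack x = w"
  then show "\<forall>i<length w. \<forall>j<length w. x ! i \<le> x ! j \<longleftrightarrow> w ! i \<le> w ! j"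
    using pack_le_iff[of _ x] len by auto
next
  assume same: "\<forall>i<length w. \<forall>j<length w. x ! i \<le> x ! j \<longleftrightarrow> w ! i \<le> w ! j"
  have "pack x = pack w"
  proof (rule nth_equalityI)
    fix i assume "i < length (pack x)"
    then have i: "i < length w" using len by simp
    let ?S = "{j. j < length w \<and> w ! j \<le> w ! i}"
    have "{b \<in> set x. b \<le> x ! i} = (!) x ` ?S"
      using same i len by (auto simp: in_set_conv_nth)
    moreover have "{b \<in> set w. b \<le> w ! i} = (!) w ` ?S"
      by (auto simp: in_set_conv_nth)
    moreover have "card ((!) x ` ?S) = card ((!) w ` ?S)"
      by (rule card_image_eq_if_same_kernel) (use same in \<open>auto simp: order_eq_iff\<close>)
    ultimately show "pack x ! i = pack w ! i" using i len by (simp add: pack_def)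
  qed (simp add: len)
  then show "pack x = w" using pack_packed[OF assms(1)] by simp
qed

section \<open>Words with a prescribed order on each block\<close>

text \<open>Positions in different blocks of \<open>u\<close> are left unrelated. If
  \<open>w\<close> is packed, as long as \<open>u\<close> and finer than \<open>u\<close>, these are
  the words \<open>x\<close> over \<open>{1..N}\<close> with
  \<open>pack (zip u x) = w\<close>.\<close>

definition same_order_words :: "nat \<Rightarrow> nat list \<Rightarrow> nat list \<Rightarrow> nat list set" where
  "same_order_words N u w = {x. length x = length u \<and> set x \<subseteq> {1..N} \<and>
     (\<forall>i<length u. \<forall>j<length u. u ! i = u ! j \<longrightarrow> (x ! i \<le> x ! j \<longleftrightarrow> w ! i \<le> w ! j))}"

abbreviation letters :: "nat list \<Rightarrow> nat list \<Rightarrow> nat \<Rightarrow> nat set" where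
  "letters w u i \<equiv> {w ! j |j. j < length u \<and> u ! j = i}"

lemma finite_letters: "finite (letters w u i)"
  by (rule finite_subset[of _ "(!) w ` {..<length u}"]) auto

lemma nth_sorted_list_of_set_le_iff:
  fixes A :: "'a::linorder set"
  assumes "a < card A" "b < card A"
  shows "sorted_list_of_set A ! a \<le> sorted_list_of_set A ! b \<longleftrightarrow> a \<le> b"
proof -
  have "sorted_wrt (<) (sorted_list_of_set A)" by (rule strict_sorted_list_of_set)
  then show ?thesis using assms
    by (metis leD le_less_linear length_sorted_list_of_set nless_le sorted_wrt_nth_less)
qed

lemma nat_mono_rank_le_iff:
  fixes W :: "nat set"
  assumes "finite W" "x \<in> W" "y \<in> W"
  shows "card {b \<in> W. b < x} \<le> card {b \<in> W. b < y} \<longleftrightarrow> x \<le> y"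
proof -
  have "card {b \<in> W. b < x} \<le> card {b \<in> W. b < y}" if "x \<le> y" for x y
    by (rule card_mono) (use assms(1) that in auto)
  moreover have "card {b \<in> W. b < y} < card {b \<in> W. b < x}" if "y < x" "y \<in> W" for x y
    by (rule psubset_card_mono) (use assms(1) that in auto)
  ultimately show ?thesis using assms by (meson not_le)
qed

text \<open>A word whose order on every block of \<open>u\<close> is that of \<open>w\<close> is determined by the sets of its
  letters on these blocks, and those sets can be prescribed freely.\<close>

lemma card_same_order_words:
  "card (same_order_words N u w) = (\<Prod>i\<in>set u. N choose ell w u i)"
proof -
  let ?X = "same_order_words N u w"
  let ?T = "PiE (set u) (\<lambda>i. {A. A \<subseteq> {1..N} \<and> card A = ell w u i})"
  let ?F = "\<lambda>x. restrict (letters x u) (set u)"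
  have im: "letters x u i = (!) x ` {j. j < length u \<and> u ! j = i}" for x i
    by auto
  have eq_iff: "x ! k = x ! l \<longleftrightarrow> w ! k = w ! l"
    if "x \<in> ?X" "k < length u" "l < length u" "u ! k = u ! l" for x k l
  proof -
    have "x ! k \<le> x ! l \<longleftrightarrow> w ! k \<le> w ! l" "x ! l \<le> x ! k \<longleftrightarrow> w ! l \<le> w ! k"
      using that by (simp_all add: same_order_words_def)
    then show ?thesis unfolding order_eq_iff by simp
  qed
  have card_eq: "card (letters x u i) = ell w u i" if "x \<in> ?X" for x i
    unfolding ell_def im
    by (rule card_image_eq_if_same_kernel)
       (use that eq_iff in auto)
  \<comment> \<open>Within its block a letter of \<open>x\<close> has the rank that \<open>w\<close>
    prescribes, so the letter set of the block determines it.\<close>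
  have rank: "card {b \<in> letters x u (u ! j). b < x ! j} = card {b \<in> letters w u (u ! j). b < w ! j}"
    if x: "x \<in> ?X" and j: "j < length u" for x j
  proof -
    let ?S = "{k. k < length u \<and> u ! k = u ! j \<and> w ! k < w ! j}"
    have less: "x ! k < x ! l \<longleftrightarrow> w ! k < w ! l"
      if "k < length u" "l < length u" "u ! k = u ! l" for k l
      using x that by (simp add: same_order_words_def flip: not_le)
    have 1: "{b \<in> letters x u (u ! j). b < x ! j} = (!) x ` ?S"
      using j less by auto
    have 2: "{b \<in> letters w u (u ! j). b < w ! j} = (!) w ` ?S"
      by auto
    show ?thesis unfolding 1 2
      by (rule card_image_eq_if_same_kernel)
         (use x eq_iff in auto)
  qed
  have "bij_betw ?F ?X ?T"
  proof (rule bij_betw_imageI)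
    show "inj_on ?F ?X"
    proof (rule inj_onI)
      fix x y assume x: "x \<in> ?X" and y: "y \<in> ?X" and eq: "?F x = ?F y"
      show "x = y"
      proof (rule nth_equalityI)
        show "length x = length y" using x y by (simp add: same_order_words_def)
        fix j assume "j < length x"
        then have j: "j < length u" using x by (simp add: same_order_words_def)
        then have L: "letters x u (u ! j) = letters y u (u ! j)"
          using fun_cong[OF eq, of "u ! j"] by simp
        let ?W = "letters x u (u ! j)"
        have W: "x ! j \<in> ?W" using j by blast
        have W': "y ! j \<in> ?W" unfolding L using j by blast
        have "card {b \<in> ?W. b < x ! j} = card {b \<in> ?W. b < y ! j}"
          using rank[OF x j] rank[OF y j] L by simp
        then show "x ! j = y ! j"
          using nat_mono_rank_le_iff[OF finite_letters W W'] nat_mono_rank_le_iff[OF finite_letters W' W]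
          by simp
      qed
    qed
    show "?F ` ?X = ?T"
    proof (intro equalityI subsetI)
      fix A assume "A \<in> ?F ` ?X"
      then obtain x where x: "x \<in> ?X" "A = ?F x" by blast
      have "letters x u i \<subseteq> set x" for i
        using x(1) by (auto simp: same_order_words_def)
      then have "letters x u i \<subseteq> {1..N}" for i
        using x(1) unfolding same_order_words_def by blast
      then show "A \<in> ?T" using x card_eq by auto
    next
      fix A assume A: "A \<in> ?T"
      let ?W = "\<lambda>i. letters w u i"
      \<comment> \<open>The strict inequality makes ranks start at 0, as list indices do. The
        preimage of \<open>A\<close> puts at \<open>j\<close> the element of
        \<open>A (u ! j)\<close> with the rank of \<open>w ! j\<close>.\<close>
      define rk where "rk j = card {b \<in> ?W (u ! j). b < w ! j}" for j
      define x where "x = map (\<lambda>j. sorted_list_of_set (A (u ! j)) ! rk j) [0..<length u]"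
      have x: "x ! j = sorted_list_of_set (A (u ! j)) ! rk j" if "j < length u" for j
        using that by (simp add: x_def)
      have Ai: "A i \<subseteq> {1..N}" "card (A i) = card (?W i)" "finite (A i)" if "i \<in> set u" for i
        using PiE_mem[OF A that] by (auto simp: ell_def intro: finite_subset)
      have rk: "rk j < card (A (u ! j))" if "j < length u" for j
        unfolding rk_def Ai(2)[OF nth_mem[OF that]]
        by (rule psubset_card_mono) (use that finite_letters in auto)
      have xA: "x ! j \<in> A (u ! j)" if "j < length u" for j
        using rk[OF that] Ai(3)[OF nth_mem[OF that]] x[OF that]
        by (metis length_sorted_list_of_set nth_mem set_sorted_list_of_set)
      have xle: "x ! i \<le> x ! j \<longleftrightarrow> w ! i \<le> w ! j"
        if ij: "i < length u" "j < length u" "u ! i = u ! j" for i j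
      proof -
        have "x ! i \<le> x ! j \<longleftrightarrow> rk i \<le> rk j"
          using nth_sorted_list_of_set_le_iff[of "rk i" "A (u ! j)" "rk j"] rk ij
          by (metis x)
        also have "\<dots> \<longleftrightarrow> w ! i \<le> w ! j"
          unfolding rk_def ij(3)
          by (rule nat_mono_rank_le_iff) (use ij finite_letters in auto)
        finally show ?thesis .
      qed
      have xX: "x \<in> ?X"
        unfolding same_order_words_def
      proof (intro CollectI conjI)
        show "length x = length u" by (simp add: x_def)
        moreover have "x ! j \<in> {1..N}" if "j < length u" for j
          using xA[OF that] Ai(1)[OF nth_mem[OF that]] by blast
        ultimately show "set x \<subseteq> {1..N}"
          by (metis in_set_conv_nth subsetI)
      qed (use xle in blast)
      \<comment> \<open>One inclusion and equal cardinalities suffice.\<close>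
      have "letters x u i = A i" if "i \<in> set u" for i
        by (rule card_subset_eq) (use Ai[OF that] xA card_eq[OF xX] in \<open>auto simp: ell_def\<close>)
      then have "?F x = A"
        using A by (intro ext) (auto simp: PiE_def extensional_def)
      with xX show "A \<in> ?F ` ?X" by blast
    qed
  qed
  then have "card ?X = card ?T" by (rule bij_betw_same_card)
  also have "\<dots> = (\<Prod>i\<in>set u. N choose ell w u i)"
    by (simp add: card_PiE n_subsets)
  finally show ?thesis .
qed

text \<open>The constant word has a single block, on which the order pattern of \<open>v\<close> is
  all of \<open>pack x = v\<close>.\<close>

lemma card_words_with_pack:
  assumes "v \<in> packed_words n"
  shows "card {x :: nat list. length x = n \<and> set x \<subseteq> {1..N} \<and> pack x = v} = N choose wmax v"
proof -
  have v: "packed v" "length v = n" using assms by (auto simp: packed_words_def)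
  let ?u = "replicate n (1::nat)"
  have "{x :: nat list. length x = n \<and> set x \<subseteq> {1..N} \<and> pack x = v} = same_order_words N ?u v"
    using v pack_eq_iff[OF v(1)] by (auto simp: same_order_words_def)
  moreover have "ell v ?u 1 = wmax v"
  proof -
    have "letters v ?u 1 = set v" using v(2) by (force simp: in_set_conv_nth)
    then show ?thesis using packed_set_eq[OF v(1)] by (simp add: ell_def)
  qed
  \<comment> \<open>For \<open>n = 0\<close> there is no block: the empty product 1 must match
    \<open>N choose 0\<close>.\<close>
  moreover have "wmax v = 0" if "n = 0" using v that by (simp add: wmax_def)
  ultimately show ?thesis by (cases "n = 0") (simp_all add: card_same_order_words)
qed

section \<open>Packed biwords and refinement\<close>

text \<open>Across different blocks of \<open>u\<close>, refinement makes \<open>w\<close> compare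
  positions as the top letters do, so only comparisons inside a block remain.\<close>

lemma pack_zip_eq_iff:
  assumes u: "packed u" and w: "packed w" and len: "length w = length u" "length v = length u"
    and fin: "finer w u"
  shows "pack (zip u v) = w \<longleftrightarrow>
    (\<forall>i<length u. \<forall>j<length u. u ! i = u ! j \<longrightarrow> (v ! i \<le> v ! j \<longleftrightarrow> w ! i \<le> w ! j))"
proof -
  have mono: "u ! i \<le> u ! j" if "i < length u" "j < length u" "w ! i \<le> w ! j" for i j
    using fin finer_iff[OF u w len(1)] that by blast
  have "(zip u v ! i \<le> zip u v ! j \<longleftrightarrow> w ! i \<le> w ! j) \<longleftrightarrow>
        (u ! i = u ! j \<longrightarrow> (v ! i \<le> v ! j \<longleftrightarrow> w ! i \<le> w ! j))"
    if ij: "i < length u" "j < length u" for i j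
  proof -
    consider "u ! i < u ! j" "w ! i < w ! j" | "u ! i = u ! j" | "u ! j < u ! i" "w ! j < w ! i"
      using mono[OF ij] mono[OF ij(2,1)] by force
    then show ?thesis using ij len by cases (auto simp: less_eq_prod_def)
  qed
  then show ?thesis using pack_eq_iff[OF w, of "zip u v"] len by auto
qed

text \<open>The top letter has priority, so a comparison of biletters implies the same weak
  comparison in \<open>u\<close>.\<close>

lemma finer_pack_zip:
  assumes "packed u" "length v = length u"
  shows "finer (pack (zip u v)) u"
  by (subst finer_iff) (use assms packed_pack in \<open>auto simp: pack_le_iff less_eq_prod_def\<close>)

lemma pack_in_packed_words: "length x = n \<Longrightarrow> pack x \<in> packed_words n"
  by (simp add: packed_words_def packed_pack)

section \<open>The product identity for binomial polynomials\<close>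

text \<open>In characteristic 0 the natural numbers give infinitely many roots of
  \<open>p - q\<close>.\<close>

lemma poly_eq_if_eq_on_nats:
  fixes p q :: "'k::field_char_0 poly"
  assumes "\<And>N::nat. poly p (of_nat N) = poly q (of_nat N)"
  shows "p = q"
proof (rule ccontr)
  assume "p \<noteq> q"
  then have "finite {x. poly (p - q) x = 0}" by (intro poly_roots_finite) simp
  then have "finite (range (of_nat :: nat \<Rightarrow> 'k))"
    by (rule finite_subset[rotated]) (use assms in auto)
  then show False by (simp add: finite_image_iff inj_of_nat)
qed

text \<open>At \<open>t = N\<close> both sides count the words over \<open>{1..N}\<close> whose order on every block of \<open>u\<close> is
  that of \<open>w\<close>; on the left they are sorted by their packings.\<close>

lemma sum_binom_poly_eq_prod:
  assumes u: "packed u" and w: "packed w" "length w = length u" and fin: "finer w u"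
  shows "(\<Sum>v\<in>{v \<in> packed_words (length u). pack (zip u v) = w}. binom_poly (wmax v)) =
    (\<Prod>i\<in>set u. binom_poly (ell w u i) :: 'k::field_char_0 poly)"
    (is "?L = ?R")
proof (rule poly_eq_if_eq_on_nats)
  fix N :: nat
  let ?n = "length u"
  let ?V = "{v \<in> packed_words ?n. pack (zip u v) = w}"
  let ?C = "\<lambda>v. {x :: nat list. length x = ?n \<and> set x \<subseteq> {1..N} \<and> pack x = v}"
  have finC: "finite (?C v)" for v
    by (rule finite_subset[OF _ finite_lists_length_eq[of "{1..N}" ?n]]) auto
  \<comment> \<open>Packing \<open>x\<close> preserves its comparisons, so the criterion can be read
    on \<open>x\<close> itself.\<close>
  have pz: "pack (zip u (pack x)) = w \<longleftrightarrow>
      (\<forall>i<?n. \<forall>j<?n. u ! i = u ! j \<longrightarrow> (x ! i \<le> x ! j \<longleftrightarrow> w ! i \<le> w ! j))" if "length x = ?n" for x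
    using pack_zip_eq_iff[OF u w(1,2) _ fin, of "pack x"] that by (simp add: pack_le_iff)
  have "same_order_words N u w = (\<Union>v\<in>?V. ?C v)"
    using pz by (auto simp: same_order_words_def pack_in_packed_words)
  then have "card (same_order_words N u w) = (\<Sum>v\<in>?V. card (?C v))"
    using finC by (simp only:) (rule card_UN_disjoint, auto simp: finite_packed_words)
  also have "\<dots> = (\<Sum>v\<in>?V. N choose wmax v)"
    by (rule sum.cong) (use card_words_with_pack in auto)
  finally have eq: "(\<Sum>v\<in>?V. N choose wmax v) = (\<Prod>i\<in>set u. N choose ell w u i)"
    by (simp add: card_same_order_words)
  have "poly ?L (of_nat N) = of_nat (\<Sum>v\<in>?V. N choose wmax v)"
    by (simp add: poly_sum poly_binom_poly binomial_gbinomial)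
  also have "\<dots> = poly ?R (of_nat N)"
    unfolding eq by (simp add: poly_prod poly_binom_poly binomial_gbinomial)
  finally show "poly ?L (of_nat N) = poly ?R (of_nat N)" .
qed

section \<open>Lowest coefficients\<close>

text \<open>The factor with \<open>i = 0\<close> is the indeterminate; the others contribute
  \<open>(-1) ^ (l - 1) * fact (l - 1)\<close> at 0, to be divided by \<open>fact l\<close>.\<close>

lemma binom_poly_factor:
  assumes "l > 0"
  obtains q :: "'k::field_char_0 poly"
  where "binom_poly l = [:0, 1:] * q" "coeff q 0 = (-1) ^ (l - 1) / of_nat l"
proof -
  obtain m where l: "l = Suc m" using assms by (cases l) auto
  define q :: "'k poly" where
    "q = smult (inverse (fact l)) (\<Prod>i<m. [:0, 1:] - of_nat (Suc i))"
  have "(\<Prod>i<l. [:0, 1:] - of_nat i :: 'k poly) = [:0, 1:] * (\<Prod>i<m. [:0, 1:] - of_nat (Suc i))"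
    unfolding l by (subst prod.lessThan_Suc_shift) simp
  then have "binom_poly l = [:0, 1:] * q"
    by (simp only: binom_poly_def q_def mult_smult_right)
  moreover have "coeff q 0 = (-1) ^ (l - 1) / of_nat l"
  proof -
    have "(\<Prod>i<m. - of_nat (Suc i) :: 'k) = (-1) ^ m * (\<Prod>i<m. of_nat (Suc i))"
      by (induction m) (auto simp: algebra_simps)
    also have "(\<Prod>i<m. of_nat (Suc i) :: 'k) = fact m"
      by (simp add: fact_prod_Suc lessThan_atLeast0)
    finally have "coeff q 0 = inverse (fact l) * ((-1) ^ m * fact m)"
      by (simp add: q_def poly_0_coeff_0[symmetric] poly_prod)
    also have "fact l = (of_nat l * fact m :: 'k)" by (simp add: l)
    finally show ?thesis by (simp add: l divide_inverse)
  qed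
  ultimately show ?thesis using that by blast
qed

text \<open>One indeterminate comes out of each factor, leaving the product of the constant terms of
  the cofactors.\<close>

lemma coeff_prod_binom_poly:
  assumes "finite I" "\<And>i. i \<in> I \<Longrightarrow> l i > 0"
  shows "coeff (\<Prod>i\<in>I. binom_poly (l i)) (card I) =
    (\<Prod>i\<in>I. (-1) ^ (l i - 1) / of_nat (l i) :: 'k::field_char_0)"
proof -
  have "\<forall>i\<in>I. \<exists>q. binom_poly (l i) = [:0, 1:] * q \<and> coeff q 0 = (-1) ^ (l i - 1) / (of_nat (l i) :: 'k)"
    using binom_poly_factor assms(2) by metis
  then obtain q where q: "\<And>i. i \<in> I \<Longrightarrow> binom_poly (l i) = [:0, 1:] * q i"
      "\<And>i. i \<in> I \<Longrightarrow> coeff (q i) 0 = (-1) ^ (l i - 1) / (of_nat (l i) :: 'k)"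
    by metis
  have "(\<Prod>i\<in>I. binom_poly (l i)) = (\<Prod>i\<in>I. [:0, 1:] * q i)"
    by (rule prod.cong) (use q in auto)
  also have "\<dots> = monom 1 (card I) * (\<Prod>i\<in>I. q i)"
    by (simp only: prod.distrib prod_constant) (simp add: monom_altdef)
  finally have "coeff (\<Prod>i\<in>I. binom_poly (l i)) (card I) = coeff (\<Prod>i\<in>I. q i) 0"
    by (simp add: coeff_monom_mult)
  also have "\<dots> = (\<Prod>i\<in>I. coeff (q i) 0)"
    by (simp add: poly_0_coeff_0[symmetric] poly_prod)
  finally show ?thesis using q(2) by simp
qed

lemma ell_pos:
  assumes "i \<in> set u" shows "ell w u i > 0"
  using assms finite_letters[of u w i] by (auto simp: ell_def card_gt_0_iff in_set_conv_nth)

text \<open>Equal letters of \<open>w\<close> force equal letters of \<open>u\<close>, so the blocks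
  of \<open>u\<close> partition the letters of \<open>w\<close>. This yields the exponent of the
  sign.\<close>

lemma sum_ell:
  assumes u: "packed u" and w: "packed w" "length w = length u" and fin: "finer w u"
  shows "(\<Sum>i\<in>set u. ell w u i) = wmax w"
proof -
  have mono: "u ! i \<le> u ! j" if "i < length u" "j < length u" "w ! i \<le> w ! j" for i j
    using fin finer_iff[OF u w] that by blast
  have "set w = (\<Union>i\<in>set u. letters w u i)"
    using w(2) by (fastforce simp: in_set_conv_nth)
  moreover have "letters w u i \<inter> letters w u j = {}" if "i \<noteq> j" for i j
    using that mono by (fastforce simp: order_eq_iff)
  then have "card (\<Union>i\<in>set u. letters w u i) = (\<Sum>i\<in>set u. card (letters w u i))"
    using finite_letters by (intro card_UN_disjoint) auto
  ultimately have "(\<Sum>i\<in>set u. ell w u i) = card (set w)" by (simp add: ell_def)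
  then show ?thesis using packed_set_eq[OF w(1)] by simp
qed

section \<open>The coefficients of \<open>K_elt u\<close>\<close>

text \<open>Coefficient extraction is linear; keeping it outside the sum lets the polynomial
  identity apply first.\<close>

lemma lookup_K_elt:
  assumes "packed u"
  shows "Poly_Mapping.lookup (K_elt u :: nat list \<Rightarrow>\<^sub>0 'k::field_char_0) w =
    coeff (\<Sum>v\<in>{v \<in> packed_words (length u). pack (zip u v) = w}. binom_poly (wmax v)) (wmax u)"
proof -
  let ?n = "length u"
  have "Poly_Mapping.lookup (K_elt u :: nat list \<Rightarrow>\<^sub>0 'k) w =
      (\<Sum>v\<in>packed_words ?n. if pack (zip u v) = w then coeff (binom_poly (wmax v)) (wmax u) else 0)"
    unfolding K_elt_def
    by (subst internal_prod_superset[of "{u}" "packed_words ?n"])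
       (auto simp: finite_packed_words N_elt_def[of u] in_keys_iff lookup_Eulerian lookup_sum
          lookup_N_elt intro!: sum.cong split: if_splits)
  then show ?thesis by (simp only: coeff_sum sum.inter_filter[OF finite_packed_words] if_distrib[of "\<lambda>p. coeff p _"] coeff_0)
qed

theorem mainTheorem2:
  fixes u :: "nat list" and n r :: nat
  assumes "packed u" and "length u = n" and "wmax u = r"
  shows "(K_elt u :: nat list \<Rightarrow>\<^sub>0 'k::field_char_0) =
    (\<Sum>v\<in>{v \<in> packed_words n. finer v u}.
       scale ((-1) ^ (wmax v - wmax u) / (\<Prod>i=1..r. of_nat (ell v u i))) (N_elt v))"
    (is "_ = ?R")
proof (rule poly_mapping_eqI)
  fix w
  have setu: "set u = {1..r}" using packed_set_eq[OF assms(1)] assms(3) by simp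
  have R: "Poly_Mapping.lookup ?R w = (if w \<in> packed_words n \<and> finer w u
      then (-1) ^ (wmax w - wmax u) / (\<Prod>i=1..r. of_nat (ell w u i)) else 0)"
    by (simp add: lookup_sum lookup_N_elt finite_packed_words if_distrib cong: if_cong)
  show "Poly_Mapping.lookup (K_elt u) w = Poly_Mapping.lookup ?R w"
  proof (cases "w \<in> packed_words n \<and> finer w u")
    case True
    then have w: "packed w" "length w = length u" "finer w u"
      using assms(2) by (auto simp: packed_words_def)
    \<comment> \<open>Every \<open>ell w u i\<close> is positive, so the truncated subtraction is
      exact.\<close>
    have "(\<Sum>i\<in>set u. ell w u i - 1) = (\<Sum>i\<in>set u. ell w u i) - (\<Sum>i\<in>set u. 1)"
      by (rule sum_subtractf_nat) (use ell_pos in \<open>auto simp: Suc_le_eq\<close>)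
    then have exponent: "(\<Sum>i\<in>set u. ell w u i - 1) = wmax w - wmax u"
      using sum_ell[OF assms(1) w] setu assms(3) by simp
    have "Poly_Mapping.lookup (K_elt u :: nat list \<Rightarrow>\<^sub>0 'k) w =
        coeff (\<Prod>i\<in>set u. binom_poly (ell w u i)) (card (set u))"
      using setu assms(3) by (simp add: lookup_K_elt[OF assms(1)] sum_binom_poly_eq_prod[OF assms(1) w])
    also have "\<dots> = (\<Prod>i\<in>set u. (-1) ^ (ell w u i - 1) / of_nat (ell w u i))"
      by (rule coeff_prod_binom_poly) (auto intro: ell_pos)
    also have "\<dots> = (-1) ^ (wmax w - wmax u) / (\<Prod>i\<in>set u. of_nat (ell w u i))"
      by (simp only: prod_dividef power_sum[symmetric] exponent)
    finally show ?thesis using True by (simp only: R setu simp_thms if_True)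
  next
    case False
    \<comment> \<open>Any \<open>pack (zip u v)\<close> with \<open>v\<close> of length
      \<open>n\<close> is a packed word of length \<open>n\<close> finer than \<open>u\<close>,
      which \<open>w\<close> is not.\<close>
    then have "{v \<in> packed_words (length u). pack (zip u v) = w} = {}"
      using finer_pack_zip[OF assms(1)] assms(2) pack_in_packed_words[of "zip u _" n]
      by (auto simp: packed_words_def packed_pack)
    then show ?thesis using False by (simp only: R lookup_K_elt[OF assms(1)]) simp
  qed
qed

end
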